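(* Let $\alpha$ be an umbra with real moments $a_n=E[\alpha^n]$, $a_0=1$. For every nonnegative integer $k$, the family of polynomials, indexed by $t\ge 0$, $$Q_k(x,t)=E[(x-t\mathbf{.}\alpha)^k]\in\mathbb{R}[x]$$ is time-space harmonic with respect to the family of auxiliary umbrae $\{t\mathbf{.}\alpha\}_{t\ge 0}$.
   Context: An umbra $\alpha$ is a symbol representing a sequence $a_0=1,a_1,a_2,\ldots$ of real numbers through a linear evaluation functional $E$ with $E[\alpha^n]=a_n$ (the $n$-th moment); $E$ is linear over $\mathbb{R}[x]$, $E[1]=1$, and $E$ is multiplicative on monomials in distinct (uncorrelated) umbrae. For $t\in\mathbb{R}$, $t\mathbf{.}\alpha$ is the auxiliary umbra with moments $E[(t\mathbf{.}\alpha)^0]=1$ and $E[(t\mathbf{.}\alpha)^i]=\sum_{m=1}^i (t)_m B_{i,m}(a_1,\ldots,a_{i-m+1})$ for $i\ge1$, where $(t)_m=t(t-1)\cdots(t-m+1)$ and $B_{i,m}$ are the partial exponential Bell polynomials. Equivalently, $\sum_i E[(t\mathbf{.}\alpha)^i]z^i/i!=\big(\sum_n a_n z^n/n!\big)^t$ as formal power series. $-t\mathbf{.}\alpha$ is obtained by replacing $t$ with $-t$, and $x-t\mathbf{.}\alpha$ means $x+(-t\mathbf{.}\alpha)$, so that $E[(x-t\mathbf{.}\alpha)^k]=\sum_{j=0}^k\binom{k}{j}x^{k-j}E[(-t\mathbf{.}\alpha)^j]$. Conditional evaluation: for $0\le s\le t$, $E[\,\cdot\mid s\mathbf{.}\alpha]$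 is the linear map from real polynomials in the symbol $t\mathbf{.}\alpha$ to real polynomials in the symbol $s\mathbf{.}\alpha$ (which is treated as an indeterminate) given by $E[(t\mathbf{.}\alpha)^k\mid s\mathbf{.}\alpha]=\sum_{j=0}^k\binom{k}{j}(s\mathbf{.}\alpha)^j\,E[((t-s)\mathbf{.}\alpha')^{k-j}]$, where $\alpha'$ is an umbra uncorrelated with $\alpha$ and with the same moments. A family $\{P(x,t)\}_{t\ge0}\subset\mathbb{R}[x]$ is time-space harmonic with respect to $\{t\mathbf{.}\alpha\}_{t\ge0}$ if $E[P(t\mathbf{.}\alpha,t)\mid s\mathbf{.}\alpha]=P(s\mathbf{.}\alpha,s)$ for all $0\le s\le t$, as polynomials in the symbol $s\mathbf{.}\alpha$. *)

theory Defs
  imports Complex_Main "HOL-Library.FuncSet" "HOL-Computational_Algebra.Polynomial"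
begin

text \<open>
  An umbra enters only through its moments, so it is represented by its moment sequence
  \<open>a :: nat \<Rightarrow> real\<close> with \<open>a 0 = 1\<close>.  Uncorrelated umbrae with the same moments (such as \<open>\<alpha>\<close> and
  \<open>\<alpha>'\<close> in the conditional evaluation below) are thus represented by the same sequence.
\<close>

text \<open>
  Evaluation of a polynomial in an umbra with moments \<open>a\<close>.  The outer polynomial variable is the
  umbra and the coefficients are in \<open>\<real>[x]\<close>: this is the \<open>\<real>[x]\<close>-linear map that sends the
  \<open>n\<close>-th power of the umbra to \<open>a n\<close>.
\<close>

definition umbral_eval :: "(nat \<Rightarrow> real) \<Rightarrow> real poly poly \<Rightarrow> real poly" where
  "umbral_eval a p = (\<Sum>n\<le>degree p. smult (a n) (coeff p n))"

text \<open>
  The index set of the partial exponential Bell polynomial \<open>B\<^bsub>i,m\<^esub>\<close>: all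
  \<open>(j\<^sub>1, \<dots>, j\<^bsub>i-m+1\<^esub>)\<close> with \<open>j\<^sub>1 + j\<^sub>2 + \<dots> = m\<close> and \<open>j\<^sub>1 + 2 j\<^sub>2 + \<dots> = i\<close>.
\<close>

definition bell_index :: "nat \<Rightarrow> nat \<Rightarrow> (nat \<Rightarrow> nat) set" where
  "bell_index i m = {j \<in> {1..i - m + 1} \<rightarrow>\<^sub>E UNIV.
     (\<Sum>l=1..i - m + 1. j l) = m \<and> (\<Sum>l=1..i - m + 1. l * j l) = i}"

lemma finite_bell_index: "finite (bell_index i m)"
proof (rule finite_subset)
  show "bell_index i m \<subseteq> {1..i - m + 1} \<rightarrow>\<^sub>E {..m}"
  proof
    fix j assume j: "j \<in> bell_index i m"
    have "j l \<le> m" if "l \<in> {1..i - m + 1}" for l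
      using member_le_sum[OF that, of j] j by (simp add: bell_index_def)
    then show "j \<in> {1..i - m + 1} \<rightarrow>\<^sub>E {..m}"
      using j by (auto simp: bell_index_def PiE_iff)
  qed
qed (rule finite_PiE, auto)

definition bell_poly :: "nat \<Rightarrow> nat \<Rightarrow> (nat \<Rightarrow> real) \<Rightarrow> real" where
  "bell_poly i m a = (\<Sum>j\<in>bell_index i m.
     fact i / (\<Prod>l=1..i - m + 1. fact (j l)) * (\<Prod>l=1..i - m + 1. (a l / fact l) ^ j l))"

definition falling_factorial :: "real \<Rightarrow> nat \<Rightarrow> real" where
  "falling_factorial t m = (\<Prod>r<m. t - real r)"

text \<open>The moments of the auxiliary umbra \<open>t.\<alpha>\<close>, where \<open>\<alpha>\<close> has moments \<open>a\<close>.\<close>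

definition dot_moment :: "real \<Rightarrow> (nat \<Rightarrow> real) \<Rightarrow> nat \<Rightarrow> real" where
  "dot_moment t a i =
     (if i = 0 then 1 else (\<Sum>m=1..i. falling_factorial t m * bell_poly i m a))"

text \<open>
  The conditional evaluation \<open>E[p(t.\<alpha>) | s.\<alpha>]\<close>.  In the argument \<open>p\<close> the polynomial variable is
  the symbol \<open>t.\<alpha>\<close>; in the result it is the symbol \<open>s.\<alpha>\<close>.  The inner sum is the image of the
  power \<open>(t.\<alpha>)\<^sup>k\<close>, extended linearly.
\<close>

definition cond_eval :: "(nat \<Rightarrow> real) \<Rightarrow> real \<Rightarrow> real \<Rightarrow> real poly \<Rightarrow> real poly" where
  "cond_eval a s t p = (\<Sum>k\<le>degree p. smult (coeff p k)
     (\<Sum>j\<le>k. monom (real (k choose j) * dot_moment (t - s) a (k - j)) j))"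

text \<open>
  A family of polynomials \<open>P(x,t)\<close> in \<open>x\<close>, indexed by \<open>t \<ge> 0\<close>, is a function
  \<open>P :: real \<Rightarrow> real poly\<close> of which only the values at \<open>t \<ge> 0\<close> matter.
\<close>

definition time_space_harmonic :: "(nat \<Rightarrow> real) \<Rightarrow> (real \<Rightarrow> real poly) \<Rightarrow> bool" where
  "time_space_harmonic a P \<longleftrightarrow> (\<forall>s t. 0 \<le> s \<and> s \<le> t \<longrightarrow> cond_eval a s t (P t) = P s)"

text \<open>
  \<open>Q\<^sub>k(x,t) = E[(x - t.\<alpha>)\<^sup>k]\<close>.  Here \<open>x - t.\<alpha>\<close> means \<open>x + (-t.\<alpha>)\<close>, where \<open>-t.\<alpha>\<close> is the auxiliary
  umbra at \<open>- t\<close>, and not the negative of the umbra \<open>t.\<alpha>\<close>; so the polynomial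
  \<open>x + \<gamma>\<close> in the umbra \<open>\<gamma>\<close> is evaluated with the moments of \<open>-t.\<alpha>\<close>.
\<close>

definition Q_poly :: "(nat \<Rightarrow> real) \<Rightarrow> nat \<Rightarrow> real \<Rightarrow> real poly" where
  "Q_poly a k t = umbral_eval (dot_moment (- t) a) ([:[:0, 1:], 1:] ^ k)"

end

(*
  With f(z) = a_1 z + a_2 z^2/2! + ..., the multinomial theorem gives
  B_{i,m}(a) / i! = [z^i] f(z)^m / m!, so the moments of t.alpha have exponential generating
  function (1 + f)^t. The law of exponents (1 + f)^s (1 + f)^t = (1 + f)^(s + t) then says that
  the moments are of binomial type in t, and comparing the coefficients of each power of s.alpha
  reduces harmonicity to the case (t - s) + (-t) = -s of this convolution identity.
*)
theory Submission
  imports Defs "HOL-Computational_Algebra.Formal_Power_Series"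
begin

unbundle fps_syntax

text \<open>Dividing by n! absorbs the multinomial coefficients: a power of a sum expands into plain
  products, and the weights 1 / j_l! of \<open>bell_poly\<close> appear by themselves.\<close>

definition divided_power :: "'a::field_char_0 fps \<Rightarrow> nat \<Rightarrow> 'a fps" where
  "divided_power x n = fps_const (1 / fact n) * x ^ n"

lemma divided_power_add:
  "divided_power (x + y) m = (\<Sum>k\<le>m. divided_power x k * divided_power y (m - k))"
proof -
  have "fps_const (1 / fact m) * (of_nat (m choose k) * x ^ k * y ^ (m - k))
      = divided_power x k * divided_power y (m - k)" if "k \<le> m" for k
  proof -
    have "(1 / fact m :: 'a) * of_nat (m choose k) = (1 / fact k) * (1 / fact (m - k))"
      using that by (simp add: binomial_fact)
    then have *: "fps_const (1 / fact m :: 'a) * of_nat (m choose k)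
        = fps_const (1 / fact k) * fps_const (1 / fact (m - k))"
      by (simp only: fps_of_nat[symmetric] fps_const_mult)
    have "fps_const (1 / fact m) * (of_nat (m choose k) * x ^ k * y ^ (m - k))
        = fps_const (1 / fact m) * of_nat (m choose k) * (x ^ k * y ^ (m - k))"
      by (simp only: mult.assoc)
    also have "\<dots> = divided_power x k * divided_power y (m - k)"
      by (simp only: *) (simp only: divided_power_def mult_ac)
    finally show ?thesis .
  qed
  then show ?thesis
    by (simp add: divided_power_def[of "x + y"] binomial_ring sum_distrib_left)
qed

lemma divided_power_zero: "divided_power 0 m = (if m = 0 then 1 else 0)"
  by (simp add: divided_power_def)

lemma divided_power_monomial:
  "divided_power (fps_const c * fps_X ^ l) n = fps_const (c ^ n / fact n) * fps_X ^ (l * n)"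
  by (simp add: divided_power_def power_mult_distrib power_mult
      flip: mult.assoc)

lemma finite_multi_indices:
  fixes m :: nat
  assumes "finite A"
  shows "finite {j \<in> A \<rightarrow>\<^sub>E UNIV. sum j A = m}"
proof (rule finite_subset)
  show "{j \<in> A \<rightarrow>\<^sub>E UNIV. sum j A = m} \<subseteq> A \<rightarrow>\<^sub>E {..m}"
    using member_le_sum[OF _ _ assms] by (fastforce simp: PiE_iff)
qed (use assms in \<open>auto intro: finite_PiE\<close>)

text \<open>Multinomial theorem in divided form. Splitting off one summand \<open>x b\<close> with
  exponent k, by \<open>divided_power_add\<close>, leaves an exponent tuple on \<open>A\<close> with
  total m - k. Tuples are extensional functions, as in \<open>bell_index\<close>, whose second
  (weight) condition is still absent here.\<close>

theorem divided_power_sum: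
  assumes "finite A"
  shows "divided_power (\<Sum>l\<in>A. x l) m =
    (\<Sum>j\<in>{j \<in> A \<rightarrow>\<^sub>E UNIV. sum j A = m}. \<Prod>l\<in>A. divided_power (x l) (j l))"
  using assms
proof (induction A arbitrary: m rule: finite_induct)
  case empty
  have "{j. j = (\<lambda>x. undefined) \<and> m = 0} = (if m = 0 then {\<lambda>x. undefined} else {})"
    by auto
  then show ?case
    by (auto simp: divided_power_zero)
next
  case (insert b A)
  let ?I = "\<lambda>n. {j \<in> A \<rightarrow>\<^sub>E (UNIV :: nat set). sum j A = n}"
  let ?J = "{j \<in> insert b A \<rightarrow>\<^sub>E (UNIV :: nat set). sum j (insert b A) = m}"
  let ?u = "\<lambda>(k, j). j(b := k) :: _ \<Rightarrow> nat"
  have upd: "sum (j(b := k)) A = sum j A" "(\<Sum>l\<in>A. if l = b then k else j l) = sum j A"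
    for j :: "_ \<Rightarrow> nat" and k
    by (rule sum.cong; use insert.hyps in auto)+
  have bij: "bij_betw ?u (SIGMA k:{..m}. ?I (m - k)) ?J"
  proof (rule bij_betw_imageI)
    show "inj_on ?u (SIGMA k:{..m}. ?I (m - k))"
      by (rule inj_on_subset[OF inj_combinator[OF insert.hyps(2), of "\<lambda>_. UNIV"]]) auto
    show "?u ` (SIGMA k:{..m}. ?I (m - k)) = ?J"
    proof
      show "?u ` (SIGMA k:{..m}. ?I (m - k)) \<subseteq> ?J"
        using insert.hyps by (auto simp: upd PiE_iff extensional_def)
      show "?J \<subseteq> ?u ` (SIGMA k:{..m}. ?I (m - k))"
      proof
        fix j assume j: "j \<in> ?J"
        show "j \<in> ?u ` (SIGMA k:{..m}. ?I (m - k))"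
          \<comment> \<open>Resetting the entry at \<open>b\<close> to \<open>undefined\<close> is
            what makes the remaining tuple extensional on \<open>A\<close>.\<close>
          by (rule image_eqI[of _ _ "(j b, j(b := undefined))"])
            (use j insert.hyps in \<open>auto simp: upd PiE_iff extensional_def\<close>)
      qed
    qed
  qed
  have "divided_power (\<Sum>l\<in>insert b A. x l) m =
      (\<Sum>k\<le>m. \<Sum>j\<in>?I (m - k). divided_power (x b) k * (\<Prod>l\<in>A. divided_power (x l) (j l)))"
    using insert by (simp add: divided_power_add sum_distrib_left)
  also have "\<dots> = (\<Sum>(k, j)\<in>(SIGMA k:{..m}. ?I (m - k)).
      divided_power (x b) k * (\<Prod>l\<in>A. divided_power (x l) (j l)))"
    by (rule sum.Sigma) (use insert.hyps finite_multi_indices in auto)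
  also have "\<dots> = (\<Sum>p\<in>(SIGMA k:{..m}. ?I (m - k)).
      \<Prod>l\<in>insert b A. divided_power (x l) (?u p l))"
  proof (rule sum.cong[OF refl], unfold split_paired_all prod.case)
    fix k and j :: "_ \<Rightarrow> nat"
    have "(\<Prod>l\<in>A. divided_power (x l) ((j(b := k)) l)) = (\<Prod>l\<in>A. divided_power (x l) (j l))"
      by (rule prod.cong) (use insert.hyps in auto)
    then show "divided_power (x b) k * (\<Prod>l\<in>A. divided_power (x l) (j l))
        = (\<Prod>l\<in>insert b A. divided_power (x l) ((j(b := k)) l))"
      using insert.hyps by simp
  qed
  also have "\<dots> = (\<Sum>j\<in>?J. \<Prod>l\<in>insert b A. divided_power (x l) (j l))"
    by (rule sum.reindex_bij_betw[OF bij])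
  finally show ?case .
qed

lemma prod_const_X_power:
  "(\<Prod>l\<in>A. fps_const (c l) * fps_X ^ e l) = fps_const (\<Prod>l\<in>A. c l) * fps_X ^ (\<Sum>l\<in>A. e l)"
  for c :: "_ \<Rightarrow> 'a::comm_ring_1"
  by (induction A rule: infinite_finite_induct)
    (simp_all add: power_add mult_ac flip: fps_const_mult)

lemma fps_power_nth_cong:
  fixes f g :: "'a::comm_ring_1 fps"
  assumes "\<And>i. i \<le> n \<Longrightarrow> f $ i = g $ i"
  shows "(f ^ m) $ n = (g ^ m) $ n"
proof -
  \<comment> \<open>The induction needs all lower coefficients at once, since the Cauchy product at
    i involves every index up to i.\<close>
  have "\<forall>i\<le>n. (f ^ m) $ i = (g ^ m) $ i"
    by (induction m) (auto simp: fps_mult_nth assms intro!: sum.cong)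
  then show ?thesis
    by simp
qed

text \<open>For \<open>a 0 = 1\<close> this is the exponential generating function of the moments
  minus 1. The vanishing constant term allows it to be substituted into the binomial series.\<close>

definition egf_tail :: "(nat \<Rightarrow> 'a::field_char_0) \<Rightarrow> 'a fps" where
  "egf_tail a = Abs_fps (\<lambda>n. if n = 0 then 0 else a n / fact n)"

lemma egf_tail_nth_0 [simp]: "egf_tail a $ 0 = 0"
  by (simp add: egf_tail_def)

lemma bell_poly_eq_nth:
  assumes "m \<le> i"
  shows "bell_poly i m a = fact i / fact m * (egf_tail a ^ m) $ i"
proof -
  let ?A = "{1..i - m + 1}"
  let ?I = "{j \<in> ?A \<rightarrow>\<^sub>E UNIV. sum j ?A = m}"
  \<comment> \<open>Truncating to the part sizes available to B_{i,m} makes the sum finite, so that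
    \<open>divided_power_sum\<close> applies.\<close>
  define g where "g = (\<Sum>l\<in>?A. fps_const (a l / fact l) * fps_X ^ l)"
  have g_nth: "g $ n = (if n \<in> ?A then a n / fact n else 0)" for n
  proof -
    have "g $ n = (\<Sum>l\<in>?A. if n = l then a l / fact l else 0)"
      unfolding g_def fps_sum_nth by (rule sum.cong) auto
    then show ?thesis
      by (simp add: sum.delta')
  qed
  \<comment> \<open>As \<open>f = X F\<close>, the coefficient of \<open>f ^ m\<close> at \<open>i\<close> is that of \<open>F ^ m\<close> at \<open>i - m\<close>, so the
    terms of \<open>f\<close> beyond degree \<open>i - m + 1\<close> do not contribute.\<close>
  have shift: "(h ^ m) $ i = (fps_shift 1 h ^ m) $ (i - m)" if "h $ 0 = 0" for h :: "real fps"
  proof -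
    have "h = fps_X * fps_shift 1 h"
      using that by (auto simp: fps_eq_iff)
    then have "h ^ m = fps_X ^ m * fps_shift 1 h ^ m"
      by (metis power_mult_distrib)
    then show ?thesis
      using assms by (simp add: fps_X_power_mult_nth)
  qed
  have "(egf_tail a ^ m) $ i = (fps_shift 1 (egf_tail a) ^ m) $ (i - m)"
    by (rule shift) simp
  also have "\<dots> = (fps_shift 1 g ^ m) $ (i - m)"
    by (rule fps_power_nth_cong) (auto simp: g_nth egf_tail_def)
  also have "\<dots> = (g ^ m) $ i"
    by (rule shift[symmetric]) (simp add: g_nth)
  finally have "(egf_tail a ^ m) $ i / fact m = divided_power g m $ i"
    by (simp add: divided_power_def)
  also have "divided_power g m =
      (\<Sum>j\<in>?I. fps_const (\<Prod>l\<in>?A. (a l / fact l) ^ j l / fact (j l)) * fps_X ^ (\<Sum>l\<in>?A. l * j l))"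
    unfolding g_def
    by (subst divided_power_sum) (simp_all only: finite_atLeastAtMost divided_power_monomial prod_const_X_power)
  \<comment> \<open>Each tuple contributes one monomial of degree equal to the sum of the l * j_l.
    Reading off the coefficient at i therefore imposes the second condition of
    \<open>bell_index\<close>.\<close>
  also have "\<dots> $ i =
      (\<Sum>j\<in>?I. if (\<Sum>l\<in>?A. l * j l) = i then \<Prod>l\<in>?A. (a l / fact l) ^ j l / fact (j l) else 0)"
    unfolding fps_sum_nth by (rule sum.cong) auto
  also have "\<dots> = (\<Sum>j\<in>bell_index i m. \<Prod>l\<in>?A. (a l / fact l) ^ j l / fact (j l))"
    by (subst sum.inter_filter[symmetric, OF finite_multi_indices[OF finite_atLeastAtMost]])
      (auto intro!: sum.cong simp: bell_index_def)
  also have "\<dots> = bell_poly i m a / fact i"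
    by (simp add: bell_poly_def sum_divide_distrib prod_dividef)
  finally show ?thesis
    by (simp add: field_simps)
qed

lemma falling_factorial_eq_gbinomial: "falling_factorial t m = fact m * (t gchoose m)"
  by (simp add: falling_factorial_def gbinomial_prod_rev atLeast0LessThan)

text \<open>\<open>fps_binomial t\<close> is (1 + z)^t, with coefficients (t)_m / m!. The 1 / m! is
  the one that accompanies f^m in \<open>bell_poly_eq_nth\<close>.\<close>

lemma dot_moment_eq_nth:
  "dot_moment t a i = fact i * (fps_binomial t oo egf_tail a) $ i"
proof (cases "i = 0")
  case True
  then show ?thesis by (simp add: dot_moment_def)
next
  case False
  have "(fps_binomial t oo egf_tail a) $ i
      = (\<Sum>m=1..i. (t gchoose m) * (egf_tail a ^ m) $ i)"
    \<comment> \<open>The term m = 0 drops out because f^0 = 1 has no coefficient at i > 0.\<close>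
    using False by (simp add: fps_compose_nth sum.atLeast_Suc_atMost[of 0])
  then show ?thesis
    using False by (simp add: dot_moment_def falling_factorial_eq_gbinomial bell_poly_eq_nth
        sum_distrib_left mult_ac)
qed

text \<open>Substituting a series without constant term respects products, so the law of exponents
  for (1 + z)^t carries over; the factorials turn the Cauchy product into a binomial convolution.
  The exponents are arbitrary reals, so negative ones are covered.\<close>

theorem dot_moment_add:
  "dot_moment (s + t) a n =
    (\<Sum>i\<le>n. real (n choose i) * dot_moment s a i * dot_moment t a (n - i))"
proof -
  let ?F = "\<lambda>t. fps_binomial t oo egf_tail a"
  have "dot_moment (s + t) a n = fact n * (?F s * ?F t) $ n"
    by (simp add: dot_moment_eq_nth fps_binomial_add_mult fps_compose_mult_distrib)
  also have "\<dots> = (\<Sum>i\<le>n. fact n * (?F s $ i * ?F t $ (n - i)))"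
    by (simp add: fps_mult_nth sum_distrib_left atLeast0AtMost)
  also have "\<dots> = (\<Sum>i\<le>n. real (n choose i) * dot_moment s a i * dot_moment t a (n - i))"
    by (rule sum.cong) (auto simp: dot_moment_eq_nth binomial_fact)
  finally show ?thesis .
qed

text \<open>The outer variable is the umbra and the inner one is x, so the binomial expansion comes
  sorted by powers of the umbra. Reversing n to k - n sorts it by powers of x.\<close>

lemma coeff_Q_poly:
  "coeff (Q_poly a k t) j = (if j \<le> k then real (k choose j) * dot_moment (- t) a (k - j) else 0)"
proof -
  have "smult (dot_moment (- t) a n) (coeff ([:[:0, 1:], 1:] ^ k) n)
      = monom (real (k choose n) * dot_moment (- t) a n) (k - n)" if "n \<le> k" for n
    using that
    by (simp add: coeff_linear_poly_power of_nat_poly smult_monom mult_ac monom_altdef)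
  then have "Q_poly a k t = (\<Sum>n\<le>k. monom (real (k choose n) * dot_moment (- t) a n) (k - n))"
    unfolding Q_poly_def umbral_eval_def degree_linear_power by simp
  also have "\<dots> = (\<Sum>j\<le>k. monom (real (k choose j) * dot_moment (- t) a (k - j)) j)"
    by (rule sum.reindex_bij_witness[of _ "\<lambda>j. k - j" "\<lambda>j. k - j"])
      (auto simp: binomial_symmetric[of _ k, symmetric])
  finally show ?thesis
    by (simp add: coeff_sum if_distrib sum.delta cong: if_cong)
qed

text \<open>Any degree bound \<open>d\<close> may replace the exact degree, because the extra
  coefficients vanish. For \<open>Q_poly\<close> the bound k suffices.\<close>

lemma coeff_cond_eval:
  assumes "degree p \<le> d"
  shows "coeff (cond_eval a s t p) r =
    (\<Sum>k\<in>{r..d}. coeff p k * real (k choose r) * dot_moment (t - s) a (k - r))"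
proof -
  let ?c = "\<lambda>k. coeff p k * real (k choose r) * dot_moment (t - s) a (k - r)"
  have "coeff (cond_eval a s t p) r = (\<Sum>k\<le>degree p. if r \<le> k then ?c k else 0)"
    unfolding cond_eval_def coeff_sum coeff_smult
    by (rule sum.cong) (auto simp: sum.delta)
  also have "\<dots> = (\<Sum>k\<le>d. if r \<le> k then ?c k else 0)"
    by (rule sum.mono_neutral_left) (use assms in \<open>auto simp: coeff_eq_0\<close>)
  also have "\<dots> = (\<Sum>k\<in>{r..d}. ?c k)"
    by (subst sum.inter_filter[symmetric]) (auto intro: sum.cong)
  finally show ?thesis .
qed

text \<open>In the coefficient at r, the identity C(k,j) C(j,r) = C(k,r) C(k-r,j-r) pulls out
  C(k,r). What remains, after shifting j by r, is the convolution of \<open>dot_moment_add\<close>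
  at order k - r.\<close>

lemma cond_eval_Q_poly: "cond_eval a s t (Q_poly a k t) = Q_poly a k s"
proof (rule poly_eqI)
  fix r
  have deg: "degree (Q_poly a k t) \<le> k"
    by (rule degree_le) (simp add: coeff_Q_poly)
  show "coeff (cond_eval a s t (Q_poly a k t)) r = coeff (Q_poly a k s) r"
  proof (cases "r \<le> k")
    case True
    let ?d = "\<lambda>t. dot_moment t a"
    have "coeff (cond_eval a s t (Q_poly a k t)) r =
        (\<Sum>j\<in>{r..k}. real (k choose j) * ?d (- t) (k - j) * real (j choose r) * ?d (t - s) (j - r))"
      by (simp add: coeff_cond_eval[OF deg] coeff_Q_poly)
    also have "\<dots> = (\<Sum>j\<in>{r..k}. real (k choose r) *
        (real ((k - r) choose (j - r)) * ?d (t - s) (j - r) * ?d (- t) (k - r - (j - r))))"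
    proof (rule sum.cong[OF refl])
      fix j assume "j \<in> {r..k}"
      then have *: "real (k choose j) * real (j choose r) = real (k choose r) * real ((k - r) choose (j - r))"
        and **: "k - r - (j - r) = k - j"
        by (simp_all add: choose_mult flip: of_nat_mult)
      have "real (k choose j) * ?d (- t) (k - j) * real (j choose r) * ?d (t - s) (j - r) =
          (real (k choose j) * real (j choose r)) * (?d (t - s) (j - r) * ?d (- t) (k - j))"
        by (simp only: mult_ac)
      then show "real (k choose j) * ?d (- t) (k - j) * real (j choose r) * ?d (t - s) (j - r) =
          real (k choose r) *
          (real ((k - r) choose (j - r)) * ?d (t - s) (j - r) * ?d (- t) (k - r - (j - r)))"
        by (simp only: * ** mult.assoc)
    qed
    also have "\<dots> = (\<Sum>i\<le>k - r. real (k choose r) *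
        (real ((k - r) choose i) * ?d (t - s) i * ?d (- t) (k - r - i)))"
      by (rule sum.reindex_bij_witness[of _ "\<lambda>i. i + r" "\<lambda>j. j - r"]) (use True in auto)
    also have "\<dots> = real (k choose r) * ?d (t - s + - t) (k - r)"
      by (simp only: dot_moment_add sum_distrib_left)
    also have "\<dots> = coeff (Q_poly a k s) r"
      using True by (simp add: coeff_Q_poly)
    finally show ?thesis .
  qed (simp add: coeff_cond_eval[OF deg] coeff_Q_poly)
qed

theorem theorem3p5:
  fixes a :: "nat \<Rightarrow> real" and k :: nat
  assumes "a 0 = 1"
  shows "time_space_harmonic a (\<lambda>t. Q_poly a k t)"
  by (simp add: time_space_harmonic_def cond_eval_Q_poly)

end
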